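(* Let $X$ be a Banach space with $\dim X\ge 2$, let $\Omega\subsetneq X$ be a domain, and let $j=j_\Omega$ be the distance-ratio metric on $\Omega$. Then for every $x_0\in\Omega$ and every $0<r\le\log 2$, the $j$-ball $\mathbf{B}_j(x_0,r)$ is starlike with respect to $x_0$.
   Context: A domain is a nonempty open connected set. For $x\in\Omega$ write $d(x)=d(x,\partial\Omega)$ for the norm distance to the boundary. The distance-ratio metric ($j$-metric) on $\Omega$ is $j_\Omega(x,y)=\log\left(1+\frac{\|x-y\|}{\min\{d(x),d(y)\}}\right)$ for $x,y\in\Omega$. The closed $j$-ball is $\mathbf{B}_j(x,r)=\{y\in\Omega: j_\Omega(x,y)\le r\}$. A set $A\subset X$ is starlike with respect to $x_0\in A$ if $\{tx_0+(1-t)y:t\in[0,1]\}\subset A$ for all $y\in A$. *)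

theory Defs
  imports "HOL-Analysis.Analysis"
begin

definition is_domain :: "'a::topological_space set \<Rightarrow> bool" where
  "is_domain \<Omega> \<longleftrightarrow> open \<Omega> \<and> connected \<Omega> \<and> \<Omega> \<noteq> {}"

text \<open>
  The value \<open>infdist x {} = 0\<close> never plays a role: a nonempty proper open subset of a
  real normed space has a nonempty boundary.
\<close>

definition bdist :: "'a::metric_space set \<Rightarrow> 'a \<Rightarrow> real" where
  "bdist \<Omega> x = infdist x (frontier \<Omega>)"

definition j_metric :: "'a::real_normed_vector set \<Rightarrow> 'a \<Rightarrow> 'a \<Rightarrow> real" where
  "j_metric \<Omega> x y = ln (1 + norm (x - y) / min (bdist \<Omega> x) (bdist \<Omega> y))"

definition j_cball :: "'a::real_normed_vector set \<Rightarrow> 'a \<Rightarrow> real \<Rightarrow> 'a set" where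
  "j_cball \<Omega> x r = {y \<in> \<Omega>. j_metric \<Omega> x y \<le> r}"

text \<open>
  The library predicate \<open>starlike\<close> leaves the centre existentially quantified; here it
  is a parameter.
\<close>

definition starlike_wrt :: "'a::real_vector set \<Rightarrow> 'a \<Rightarrow> bool" where
  "starlike_wrt A x0 \<longleftrightarrow>
     x0 \<in> A \<and> (\<forall>y\<in>A. {t *\<^sub>R x0 + (1 - t) *\<^sub>R y | t. t \<in> {0..1}} \<subseteq> A)"

text \<open>
  The library constant \<open>dim\<close> is \<open>0\<close> on infinite-dimensional spaces, so a lower bound on
  the dimension, finite or infinite, is expressed by linearly independent sets.
\<close>

definition dim_at_least :: "nat \<Rightarrow> 'a::real_vector itself \<Rightarrow> bool" where
  "dim_at_least n _ \<longleftrightarrow> (\<exists>B::'a set. finite B \<and> card B = n \<and> independent B)"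

end

theory Submission imports Defs begin

text \<open>
  Put \<open>R = exp r - 1\<close>, so that \<open>0 < R \<le> 1\<close>, and let \<open>d\<close> be the distance to the boundary.
  A point \<open>y \<in> \<Omega>\<close> lies in the \<open>j\<close>-ball iff \<open>\<parallel>x - y\<parallel> \<le> R * min (d x) (d y)\<close>. For
  \<open>z = t x + (1 - t) y\<close> and \<open>s = \<parallel>x - y\<parallel>\<close>, the function \<open>d\<close> being 1-Lipschitz gives
  \<open>R * d z \<ge> R * d y - R * t * s \<ge> s - t * s = \<parallel>x - z\<parallel>\<close>; this is where \<open>R \<le> 1\<close> enters.
\<close>

text \<open>The whole space is connected, so it cannot be split into \<open>\<Omega>\<close> and its
  complement without meeting the boundary. This excludes the default value of \<open>infdist\<close>
  at the empty set.\<close>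

lemma frontier_nonempty:
  fixes \<Omega> :: "'a::real_normed_vector set"
  assumes "\<Omega> \<noteq> {}" "\<Omega> \<noteq> UNIV"
  shows "frontier \<Omega> \<noteq> {}"
  using connected_Int_frontier[of UNIV \<Omega>] assms by auto

lemma bdist_pos:
  fixes \<Omega> :: "'a::real_normed_vector set"
  assumes "open \<Omega>" "\<Omega> \<noteq> UNIV" "x \<in> \<Omega>"
  shows "bdist \<Omega> x > 0"
proof -
  have "x \<notin> frontier \<Omega>"
    using assms by (simp add: frontier_def interior_open)
  moreover have "frontier \<Omega> \<noteq> {}"
    using frontier_nonempty assms by auto
  ultimately show ?thesis
    unfolding bdist_def by (intro infdist_pos_not_in_closed) auto
qed

text \<open>The ball is connected and misses the frontier, so once it contains a point of
  \<open>\<Omega>\<close> it cannot leave \<open>\<Omega>\<close>. For radius 0 it is empty.\<close>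

lemma ball_bdist_subset:
  fixes \<Omega> :: "'a::real_normed_vector set"
  assumes "x \<in> \<Omega>"
  shows "ball x (bdist \<Omega> x) \<subseteq> \<Omega>"
proof (cases "bdist \<Omega> x > 0")
  case True
  have "ball x (bdist \<Omega> x) \<inter> frontier \<Omega> = {}"
    unfolding bdist_def by (auto simp: disjoint_iff not_less dest: infdist_le[of _ _ x])
  moreover have "x \<in> ball x (bdist \<Omega> x) \<inter> \<Omega>"
    using assms True by simp
  ultimately show ?thesis
    using connected_Int_frontier[of "ball x (bdist \<Omega> x)" \<Omega>] connected_ball by blast
qed (simp add: ball_empty)

lemma mem_j_cball_iff:
  fixes \<Omega> :: "'a::real_normed_vector set"
  assumes "open \<Omega>" "\<Omega> \<noteq> UNIV" "x \<in> \<Omega>"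
  shows "y \<in> j_cball \<Omega> x r \<longleftrightarrow>
    y \<in> \<Omega> \<and> norm (x - y) \<le> (exp r - 1) * min (bdist \<Omega> x) (bdist \<Omega> y)"
proof (cases "y \<in> \<Omega>")
  case True
  define m where "m = min (bdist \<Omega> x) (bdist \<Omega> y)"
  \<comment> \<open>Positivity rules out the default \<open>a / 0 = 0\<close> and keeps the argument
    of \<open>ln\<close> positive, so that logarithm and quotient can both be undone by
    equivalences.\<close>
  have m: "m > 0"
    using bdist_pos assms True by (auto simp: m_def)
  then have "1 + norm (x - y) / m > 0"
    by (simp add: add_pos_nonneg)
  then have "ln (1 + norm (x - y) / m) \<le> r \<longleftrightarrow> 1 + norm (x - y) / m \<le> exp r"
    using exp_le_cancel_iff[of "ln (1 + norm (x - y) / m)" r] exp_ln by simp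
  also have "\<dots> \<longleftrightarrow> norm (x - y) \<le> (exp r - 1) * m"
    using m by (simp add: field_simps)
  finally show ?thesis
    using True by (simp add: j_cball_def j_metric_def m_def)
qed (simp add: j_cball_def)

theorem theorem3p1:
  fixes \<Omega> :: "'a::banach set" and x0 :: 'a and r :: real
  assumes "dim_at_least 2 TYPE('a)"
    and "is_domain \<Omega>" and "\<Omega> \<noteq> UNIV"
    and "x0 \<in> \<Omega>"
    and "0 < r" and "r \<le> ln 2"
  shows "starlike_wrt (j_cball \<Omega> x0 r) x0"
proof -
  define R where "R = exp r - 1"
  have "exp r \<le> 2"
    using assms(6) exp_le_cancel_iff[of r "ln 2"] by simp
  then have R: "0 < R" "R \<le> 1"
    using assms(5) by (auto simp: R_def)
  have "open \<Omega>"
    using assms(2) by (simp add: is_domain_def)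
  note mem = mem_j_cball_iff[OF this assms(3,4), of _ r, folded R_def]
  note pos = bdist_pos[OF \<open>open \<Omega>\<close> assms(3)]
  have "x0 \<in> j_cball \<Omega> x0 r"
    using assms(4) pos[OF assms(4)] R by (simp add: mem)
  moreover have "t *\<^sub>R x0 + (1 - t) *\<^sub>R y \<in> j_cball \<Omega> x0 r"
    if y: "y \<in> j_cball \<Omega> x0 r" and t: "0 \<le> t" "t \<le> 1" for y t
  \<comment> \<open>The endpoint \<open>y\<close> is split off: if \<open>R = 1\<close>, it may lie
    on the sphere of radius \<open>bdist \<Omega> x0\<close> about \<open>x0\<close>, outside the
    open ball used below.\<close>
  proof (cases "t = 0")
    case True
    then show ?thesis using y by simp
  next
    case False
    define z where "z = t *\<^sub>R x0 + (1 - t) *\<^sub>R y"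
    define s where "s = norm (x0 - y)"
    have s: "0 \<le> s" "s \<le> R * bdist \<Omega> x0" "s \<le> R * bdist \<Omega> y"
      using y R by (auto simp: mem s_def min_mult_distrib_left)
    have "x0 - z = (1 - t) *\<^sub>R (x0 - y)" "y - z = t *\<^sub>R (y - x0)"
      by (auto simp: z_def algebra_simps)
    then have xz: "norm (x0 - z) = (1 - t) * s" and yz: "dist y z = t * s"
      using t by (auto simp: s_def dist_norm norm_minus_commute)
    \<comment> \<open>The bound \<open>R \<le> 1\<close> also serves to show that \<open>z\<close>
      is in \<open>\<Omega>\<close>: it puts \<open>y\<close> in the closed ball of radius
      \<open>bdist \<Omega> x0\<close> about \<open>x0\<close>, and \<open>t > 0\<close> then moves
      \<open>z\<close> into the open one.\<close>
    have "R * bdist \<Omega> x0 \<le> bdist \<Omega> x0"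
      using R pos[OF assms(4)] by simp
    then have "s \<le> bdist \<Omega> x0"
      using s by linarith
    have "(1 - t) * s < bdist \<Omega> x0"
    proof (cases "s = 0")
      case True
      then show ?thesis using pos[OF assms(4)] by simp
    next
      case False
      then have "(1 - t) * s < s"
        using s(1) t \<open>t \<noteq> 0\<close> by simp
      then show ?thesis
        using \<open>s \<le> bdist \<Omega> x0\<close> by linarith
    qed
    then have "z \<in> \<Omega>"
      using ball_bdist_subset[OF assms(4)] xz by (auto simp: dist_norm)
    have ts: "0 \<le> t * s"
      using s(1) t by simp
    have "bdist \<Omega> y \<le> bdist \<Omega> z + t * s"
      unfolding bdist_def using infdist_triangle[of y "frontier \<Omega>" z] yz by simp
    then have "R * bdist \<Omega> y \<le> R * bdist \<Omega> z + R * (t * s)"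
      using mult_left_mono[of _ _ R] R by (fastforce simp flip: distrib_left)
    \<comment> \<open>Going from \<open>y\<close> to \<open>z\<close> lowers the right-hand side
      \<open>R * bdist\<close> by at most \<open>R * (t * s)\<close>, while the distance to
      \<open>x0\<close> drops by exactly \<open>t * s\<close>.\<close>
    moreover have "R * (t * s) \<le> t * s"
      using mult_right_mono[OF R(2) ts] by simp
    ultimately have "(1 - t) * s \<le> R * bdist \<Omega> z"
      using s(3) by (simp add: left_diff_distrib)
    moreover have "(1 - t) * s \<le> R * bdist \<Omega> x0"
      using s(2) ts by (simp add: left_diff_distrib)
    ultimately have "z \<in> j_cball \<Omega> x0 r"
      using \<open>z \<in> \<Omega>\<close> xz R by (simp add: mem min_def)
    then show ?thesis
      by (simp add: z_def)
  qed
  ultimately show ?thesis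
    unfolding starlike_wrt_def by auto
qed

end
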